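(* Let $\varphi\in\Phi$ and $\psi\in\Phi\setminus\Phi_3$. If $\psi$ is convex on $(0,+\infty)$ and $\lim_{x\to+\infty}\bigl(\varphi(x)-\psi(x)\bigr)=+\infty$, then $$\lim_{x\to+\infty}\bigl(\varphi^{**}(x)-\psi(x)\bigr)=+\infty.$$
   Context: $\Phi$ is the set of all functions $\varphi:(0,+\infty)\to\mathbb{R}$ (no continuity assumed) for which there exists a real number $a$ with $\inf_{x\in(0,+\infty)}(\varphi(x)-ax)>-\infty$. For $\varphi\in\Phi$ put $\widehat{a}_\varphi=\liminf_{x\to+\infty}\frac{\varphi(x)}{x}\in\mathbb{R}\cup\{+\infty\}$. Then $\Phi_3=\{\varphi\in\Phi : \widehat{a}_\varphi<+\infty,\ \liminf_{x\to+\infty}(\varphi(x)-\widehat{a}_\varphi x)>-\infty\}$. For $\varphi\in\Phi$ let $M_\varphi=\{(a,b)\in\mathbb{R}^2 : \inf_{t\in(0,+\infty)}(\varphi(t)-at)>b\}$, and define $\varphi^{**}:(0,+\infty)\to\mathbb{R}$ by $\varphi^{**}(x)=\sup_{(a,b)\in M_\varphi}(ax+b)$. *)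

theory Defs
  imports "HOL-Analysis.Analysis"
begin

text \<open>
  A function \<open>\<phi> : (0, +\<infinity>) \<rightarrow> \<real>\<close> is represented by a total function of type
  \<open>real \<Rightarrow> real\<close>; only its values on \<open>{0<..}\<close> are ever used.
  Infima and lower limits that may be infinite are taken in \<open>ereal\<close>.
\<close>

definition Phi :: "(real \<Rightarrow> real) set" where
  "Phi = {\<phi>. \<exists>a::real. (INF x\<in>{0<..}. ereal (\<phi> x - a * x)) > -\<infinity>}"

definition a_hat :: "(real \<Rightarrow> real) \<Rightarrow> ereal" where
  "a_hat \<phi> = Liminf at_top (\<lambda>x. ereal (\<phi> x / x))"

text \<open>
  For \<open>\<phi> \<in> Phi\<close> one has \<open>a_hat \<phi> > -\<infinity>\<close>, so under the condition \<open>a_hat \<phi> < \<infinity>\<close>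
  the value \<open>real_of_ereal (a_hat \<phi>)\<close> is the genuine real number \<open>a_hat \<phi>\<close>.
\<close>

definition Phi3 :: "(real \<Rightarrow> real) set" where
  "Phi3 = {\<phi>\<in>Phi. a_hat \<phi> < \<infinity> \<and>
     Liminf at_top (\<lambda>x. ereal (\<phi> x - real_of_ereal (a_hat \<phi>) * x)) > -\<infinity>}"

definition M_set :: "(real \<Rightarrow> real) \<Rightarrow> (real \<times> real) set" where
  "M_set \<phi> = {(a, b). (INF t\<in>{0<..}. ereal (\<phi> t - a * t)) > ereal b}"

text \<open>
  For \<open>\<phi> \<in> Phi\<close> and \<open>x > 0\<close> the supremum is over a nonempty set that is bounded above
  by \<open>\<phi> x\<close>, so the supremum in \<open>real\<close> is the true one. Other values are never used.
\<close>

definition biconj :: "(real \<Rightarrow> real) \<Rightarrow> real \<Rightarrow> real" where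
  "biconj \<phi> x = (SUP (a, b)\<in>M_set \<phi>. a * x + b)"

end

theory Submission
  imports Defs
begin

text \<open>
  Since \<open>\<psi>\<close> is convex, its graph has a supporting line \<open>t \<mapsto> \<psi> x + s x * (t - x)\<close> at every \<open>x > 0\<close>.
  As \<open>\<psi> \<notin> Phi3\<close>, the value of this line at any fixed point \<open>T\<close> tends to \<open>-\<infinity>\<close> as \<open>x \<rightarrow> \<infinity>\<close>:
  otherwise \<open>\<psi>\<close> would lie above a line with the asymptotic slope \<open>Sup s\<close>. Hence, given \<open>C\<close>, the
  line at a large \<open>x\<close>, raised by \<open>C\<close>, stays below \<open>\<phi>\<close>: near the origin because it is
  very negative there while \<open>\<phi>\<close> is bounded below, and far out because \<open>\<phi> - \<psi>\<close> is large. This raised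
  line competes in the supremum defining \<open>\<phi>\<^sup>*\<^sup>*\<close>, and its value at \<open>x\<close> is \<open>\<psi> x + C\<close>.
\<close>

text \<open>The slope is the right derivative, as the infimum of the difference quotients to the
  right; openness makes every point interior.\<close>

lemma convex_on_supporting_lines:
  fixes f :: "real \<Rightarrow> real"
  assumes "convex_on I f" and "open I"
  obtains s where "\<And>x t. x \<in> I \<Longrightarrow> t \<in> I \<Longrightarrow> f x + s x * (t - x) \<le> f t"
proof
  fix x t assume "x \<in> I" "t \<in> I"
  then have "f t \<ge> f x + Inf ((\<lambda>t. (f x - f t) / (x - t)) ` ({x<..} \<inter> I)) * (t - x)"
    using assms convex_le_Inf_differential[of I f x t] by (simp add: interior_open)
  then show "f x + Inf ((\<lambda>t. (f x - f t) / (x - t)) ` ({x<..} \<inter> I)) * (t - x) \<le> f t" .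
qed

text \<open>Adding the supporting inequalities at \<open>x\<close> and at \<open>y\<close>, each
  evaluated at the other point, cancels the values of \<open>f\<close>.\<close>

lemma supporting_slopes_mono:
  fixes f :: "real \<Rightarrow> real"
  assumes "\<And>x t. x \<in> I \<Longrightarrow> t \<in> I \<Longrightarrow> f x + s x * (t - x) \<le> f t"
  shows "mono_on I s"
proof (rule mono_onI)
  fix x y assume xy: "x \<in> I" "y \<in> I" "x \<le> y"
  from assms[OF xy(1,2)] assms[OF xy(2,1)] have "0 \<le> (s y - s x) * (y - x)"
    by (simp add: algebra_simps)
  with xy(3) show "s x \<le> s y"
    by (cases "x = y") (auto simp: zero_le_mult_iff)
qed

text \<open>\<open>M_set\<close> asks for a strict bound on an infimum, which a pointwise bound with
  intercept \<open>b\<close> does not give; hence the slack from \<open>b\<close> to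
  \<open>c\<close>.\<close>

lemma M_setI:
  assumes "c > b" and "\<And>t. t > 0 \<Longrightarrow> a * t + c \<le> \<phi> t"
  shows "(a, b) \<in> M_set \<phi>"
proof -
  have "ereal c \<le> (INF t\<in>{0<..}. ereal (\<phi> t - a * t))"
    using assms(2) by (intro INF_greatest) (simp add: algebra_simps)
  with \<open>c > b\<close> show ?thesis
    by (auto simp: M_set_def intro: less_le_trans[of "ereal b" "ereal c"])
qed

lemma M_setD:
  assumes "(a, b) \<in> M_set \<phi>" and "t > 0"
  shows "a * t + b \<le> \<phi> t"
proof -
  have "ereal b < (INF t\<in>{0<..}. ereal (\<phi> t - a * t))"
    using assms(1) by (simp add: M_set_def)
  also have "\<dots> \<le> ereal (\<phi> t - a * t)"
    using assms(2) by (intro INF_lower) simp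
  finally show ?thesis by simp
qed

lemma biconj_ge:
  assumes "(a, b) \<in> M_set \<phi>" and "x > 0"
  shows "a * x + b \<le> biconj \<phi> x"
proof -
  have "bdd_above ((\<lambda>(a, b). a * x + b) ` M_set \<phi>)"
    using assms(2) by (intro bdd_aboveI[of _ "\<phi> x"]) (auto dest: M_setD)
  from cSUP_upper[OF assms(1) this] show ?thesis
    by (simp add: biconj_def)
qed

lemma PhiE:
  assumes "\<phi> \<in> Phi"
  obtains a m where "\<And>t. t > 0 \<Longrightarrow> a * t + m \<le> \<phi> t"
proof -
  from assms obtain a where "(INF x\<in>{0<..}. ereal (\<phi> x - a * x)) > -\<infinity>"
    by (auto simp: Phi_def)
  then obtain m where "ereal m < (INF x\<in>{0<..}. ereal (\<phi> x - a * x))"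
    using ereal_dense2 by blast
  then have "(a, m) \<in> M_set \<phi>"
    by (simp add: M_set_def)
  then show thesis
    by (intro that) (rule M_setD)
qed

text \<open>Squeezing \<open>\<psi> t / t\<close> between the two bounds identifies
  \<open>a_hat \<psi>\<close> as \<open>S\<close>; the lower bound then gives the remaining
  condition.\<close>

lemma Phi3I:
  assumes "\<psi> \<in> Phi"
    and lower: "\<And>t. t > T \<Longrightarrow> S * t - c \<le> \<psi> t"
    and upper: "\<And>t. t > T \<Longrightarrow> \<psi> t \<le> S * t + d"
  shows "\<psi> \<in> Phi3"
proof -
  have ev: "eventually (\<lambda>t. t > max 0 T) at_top"
    by (rule eventually_gt_at_top)
  have "((\<lambda>t. \<psi> t / t) \<longlongrightarrow> S) at_top"
  proof (rule tendsto_sandwich)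
    show "\<forall>\<^sub>F t in at_top. S - c / t \<le> \<psi> t / t"
      using ev
    proof eventually_elim
      case (elim t)
      then show ?case
        using divide_right_mono[OF lower, of t t] by (simp add: diff_divide_distrib)
    qed
    show "\<forall>\<^sub>F t in at_top. \<psi> t / t \<le> S + d / t"
      using ev
    proof eventually_elim
      case (elim t)
      then show ?case
        using divide_right_mono[OF upper, of t t] by (simp add: add_divide_distrib)
    qed
    have lim: "((\<lambda>t::real. k / t) \<longlongrightarrow> 0) at_top" for k
      by (intro tendsto_divide_0[OF tendsto_const] filterlim_at_top_imp_at_infinity filterlim_ident)
    show "((\<lambda>t. S - c / t) \<longlongrightarrow> S) at_top" "((\<lambda>t. S + d / t) \<longlongrightarrow> S) at_top"
      using tendsto_diff[OF tendsto_const lim] tendsto_add[OF tendsto_const lim] by simp_all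
  qed
  then have a_hat: "a_hat \<psi> = ereal S"
    unfolding a_hat_def by (intro lim_imp_Liminf) auto
  have "ereal (- c) \<le> Liminf at_top (\<lambda>x. ereal (\<psi> x - S * x))"
    by (intro Liminf_bounded eventually_mono[OF ev]) (use lower in \<open>force simp: algebra_simps\<close>)
  then have "Liminf at_top (\<lambda>x. ereal (\<psi> x - S * x)) > -\<infinity>"
    by (rule less_le_trans[rotated]) simp
  with assms(1) a_hat show ?thesis
    by (simp add: Phi3_def)
qed

lemma supporting_lines_tendsto_at_bot:
  fixes \<psi> :: "real \<Rightarrow> real"
  assumes "\<psi> \<in> Phi - Phi3"
    and supp: "\<And>x t. x > 0 \<Longrightarrow> t > 0 \<Longrightarrow> \<psi> x + s x * (t - x) \<le> \<psi> t"
  shows "filterlim (\<lambda>x. \<psi> x + s x * (T - x)) at_bot at_top"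
proof (rule ccontr)
  assume "\<not> ?thesis"
  then obtain K where K: "\<not> (\<forall>\<^sub>F x in at_top. \<psi> x + s x * (T - x) \<le> K)"
    by (auto simp: filterlim_at_bot)
  have mono: "mono_on {0<..} s"
    by (rule supporting_slopes_mono[of _ \<psi>]) (simp add: supp)
  \<comment> \<open>Beyond any \<open>y\<close> some supporting line still exceeds \<open>K\<close>
    at \<open>T\<close>; its slope is at least \<open>s y\<close>, and it stays below
    \<open>\<psi>\<close> at \<open>t\<close>.\<close>
  have bound: "s y * (t - T) \<le> \<psi> t - K" if "y > 0" "t > max 0 T" for y t
  proof -
    obtain x where x: "x \<ge> y" "\<psi> x + s x * (T - x) > K"
      using K by (auto simp: eventually_at_top_linorder not_le)
    have "s y * (t - T) \<le> s x * (t - T)"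
      using mono_onD[OF mono, of y x] x(1) that by (intro mult_right_mono) auto
    also have "\<dots> \<le> \<psi> t - K"
      using supp[of x t] x that by (simp add: algebra_simps)
    finally show ?thesis .
  qed
  define S where "S = (SUP y\<in>{0<..}. s y)"
  have bound': "s y \<le> (\<psi> t - K) / (t - T)" if "y > 0" "t > max 0 T" for y t
    using bound[OF that] that by (simp add: field_simps)
  obtain t0 where "t0 > max 0 T"
    using gt_ex by blast
  then have "bdd_above (s ` {0<..})"
    using bound'[of _ t0] by (intro bdd_aboveI2[of _ _ "(\<psi> t0 - K) / (t0 - T)"]) auto
  then have s_le: "s y \<le> S" if "y > 0" for y
    using that unfolding S_def by (intro cSUP_upper) auto
  have "\<psi> \<in> Phi3"
  proof (rule Phi3I)
    show "\<psi> \<in> Phi" using assms(1) by simp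
    fix t assume t: "t > max t0 1"
    with \<open>t0 > max 0 T\<close> have t': "t > max 0 T" by simp
    \<comment> \<open>The supremum over \<open>y\<close> at fixed \<open>t\<close> puts the line of
      slope \<open>S\<close> through \<open>(T, K)\<close> below \<open>\<psi>\<close>.\<close>
    have "S \<le> (\<psi> t - K) / (t - T)"
      unfolding S_def using bound'[OF _ t'] by (intro cSUP_least) auto
    with t' show "S * t - (S * T - K) \<le> \<psi> t"
      by (simp add: field_simps)
    \<comment> \<open>The supporting line at \<open>t\<close>, read at the fixed point
      \<open>1\<close>, bounds \<open>\<psi> t\<close> from above.\<close>
    have "\<psi> t \<le> \<psi> 1 + s t * (t - 1)"
      using supp[of t 1] t by (simp add: algebra_simps)
    also have "\<dots> \<le> \<psi> 1 + S * (t - 1)"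
      using s_le[of t] t by (intro add_left_mono mult_right_mono) auto
    finally show "\<psi> t \<le> S * t + (\<psi> 1 - S)"
      by (simp add: algebra_simps)
  qed
  with assms(1) show False by simp
qed

theorem theorem3p3:
  fixes \<phi> \<psi> :: "real \<Rightarrow> real"
  assumes "\<phi> \<in> Phi"
    and "\<psi> \<in> Phi - Phi3"
    and "convex_on {0<..} \<psi>"
    and "filterlim (\<lambda>x. \<phi> x - \<psi> x) at_top at_top"
  shows "filterlim (\<lambda>x. biconj \<phi> x - \<psi> x) at_top at_top"
  unfolding filterlim_at_top
proof
  fix C :: real
  obtain s where supp: "\<psi> x + s x * (t - x) \<le> \<psi> t" if "x > 0" "t > 0" for x t
    using convex_on_supporting_lines[OF assms(3)] by auto
  obtain a m where \<phi>_ge: "a * t + m \<le> \<phi> t" if "t > 0" for t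
    using PhiE[OF assms(1)] by blast
  obtain T0 where T0: "\<phi> t - \<psi> t \<ge> C + 1" if "t \<ge> T0" for t
    using assms(4) by (auto simp: filterlim_at_top eventually_at_top_linorder)
  define T where "T = max T0 0"
  \<comment> \<open>On \<open>(0, T]\<close>, \<open>m - \<bar>a\<bar> * T\<close> bounds
    \<open>\<phi>\<close> from below; \<open>C\<close> is the raise of the line and \<open>1\<close>
    the slack for \<open>M_setI\<close>.\<close>
  define K where "K = m - \<bar>a\<bar> * T - (C + 1)"
  have low: "K + C + 1 \<le> \<phi> t" if "0 < t" "t \<le> T" for t
  proof -
    have "- (\<bar>a\<bar> * T) \<le> - (\<bar>a\<bar> * t)"
      using that by (simp add: mult_left_mono)
    also have "\<dots> \<le> a * t"
      using that abs_ge_minus_self[of "a * t"] by (simp add: abs_mult)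
    finally show ?thesis
      using \<phi>_ge[of t] that by (simp add: K_def)
  qed
  have "\<forall>\<^sub>F x in at_top. \<psi> x + s x * (t - x) \<le> K" for t
    using supporting_lines_tendsto_at_bot[OF assms(2) supp] by (auto simp: filterlim_at_bot)
  \<comment> \<open>The line may be read at \<open>0\<close>, although \<open>\<psi>\<close> is only
    considered on positive reals.\<close>
  from this[of 0] this[of T] eventually_gt_at_top[of 0]
  show "\<forall>\<^sub>F x in at_top. C \<le> biconj \<phi> x - \<psi> x"
  proof eventually_elim
    case (elim x)
    have "(s x, \<psi> x - s x * x + C) \<in> M_set \<phi>"
    proof (rule M_setI)
      fix t :: real assume "t > 0"
      show "s x * t + (\<psi> x - s x * x + C + 1) \<le> \<phi> t"
      proof (cases "t \<le> T")
        case True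
        \<comment> \<open>An affine function on \<open>[0, T]\<close> is at most the larger of its
          endpoint values, and both are at most \<open>K\<close>.\<close>
        have "s x * t \<le> max 0 (s x * T)"
        proof (cases "s x \<ge> 0")
          case True
          with \<open>t \<le> T\<close> show ?thesis by (simp add: mult_left_mono le_max_iff_disj)
        next
          case False
          with \<open>t > 0\<close> show ?thesis by (simp add: mult_nonpos_nonneg le_max_iff_disj)
        qed
        with elim(1,2) have "s x * t + (\<psi> x - s x * x) \<le> K"
          by (auto simp: algebra_simps max_def split: if_splits)
        with low[OF \<open>t > 0\<close> True] show ?thesis by simp
      next
        case False
        then have "C + 1 \<le> \<phi> t - \<psi> t"
          by (intro T0) (simp add: T_def)
        with supp[OF elim(3) \<open>t > 0\<close>] show ?thesis
          by (simp add: algebra_simps)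
      qed
    qed simp
    from biconj_ge[OF this elim(3)] show ?case by simp
  qed
qed

end
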